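(* Let $\mathbf M$ be a balanced residuated partially ordered semigroup and let $\Omega$ be any $\tau$-residuation-coherent skeleton partition of $\operatorname{Sk}(\mathbf M)$. For all blocks $A,B\in\Omega$, all $x\in L_A$ and $y\in L_B$, with $C=A\vee B$, $$x\le y\iff \exists\, q\in C\quad xq\le_C y/q .$$ Indeed, whenever $x\le y$, the single witness $q=\tau(x)\tau(y)=\tau(x)\vee\tau(y)$ works (i.e. $q\in C$ and $xq\le_C y/q$). Equivalently, since this witness is central, the same target comparison may be written as $qx=xq\le_C q\backslash y$.
   Context: A residuated partially ordered semigroup is a structure $\mathbf M=\langle M,\le,\cdot,\backslash,/\rangle$ with $\langle M,\le\rangle$ a poset, $\langle M,\cdot\rangle$ a semigroup, and $xy\le z\iff x\le z/y\iff y\le x\backslash z$. An element $p\in M$ is positive if $z\le zp$ and $z\le pz$ for all $z\in M$. $\mathbf M$ is balanced if for every $x\in M$ one has $x\backslash x=x/x$ and this common value is positive; it is then automatically idempotent. Put $\tau(x):=x\backslash x=x/x$. The positive-idempotent skeleton $\operatorname{Sk}(\mathbf M)$ is the set of positive idempotents with the order inherited from $\mathbf M$; it is a join-semilattice in which $u\vee v=uv=vu$. For $A\subseteq S=\operatorname{Sk}(\mathbf M)$ put $L_A:=\{x\in M:\tau(x)\in A\}$. A skeleton partition is a partition of $S$. For $A,B\subseteq S$ put $A\star_\tau B:=\{\tau(xy),\tau(x\backslash y),\tau(x/y): x\in L_A,\ y\in L_B\}$. A skeleton partition $\Omega$ is $\tau$-residuation-coherent if for all $A,B\in\Omega$ exactly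 one block of $\Omega$ meets $A\star_\tau B$. For such $\Omega$, the operation $A\vee B:=$ the $\Omega$-block of $u\vee v$ (any $u\in A$, $v\in B$) is well defined and makes $\Omega$ a join-semilattice. $\le_C$ denotes the restriction of $\le$ to $L_C$; for $x\in L_A$, $y\in L_B$, $C=A\vee B$ and $q\in C$, the elements $xq$ and $y/q$ both lie in $L_C$, so $xq\le_C y/q$ is a comparison inside $L_C$. *)

theory Defs
  imports Main "HOL-Library.Disjoint_Sets"
begin

class residuated_posemigroup = order + semigroup_mult +
  fixes ldiv :: "'a \<Rightarrow> 'a \<Rightarrow> 'a"  (infixr "\<setminus>" 70)
    and rdiv :: "'a \<Rightarrow> 'a \<Rightarrow> 'a"  (infixl "\<oslash>" 70)
  assumes le_rdiv_iff: "x * y \<le> z \<longleftrightarrow> x \<le> z \<oslash> y"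
    and le_ldiv_iff: "x * y \<le> z \<longleftrightarrow> y \<le> x \<setminus> z"
begin

definition positive :: "'a \<Rightarrow> bool" where
  "positive p \<longleftrightarrow> (\<forall>z. z \<le> z * p \<and> z \<le> p * z)"

definition Sk :: "'a set" where
  "Sk = {p. positive p \<and> p * p = p}"

text \<open>For \<open>u\<close>, \<open>v\<close> in the skeleton of a balanced structure this least upper bound exists
  and equals \<open>u * v = v * u\<close>; it is not defined as the product.\<close>

definition sk_join :: "'a \<Rightarrow> 'a \<Rightarrow> 'a" where
  "sk_join u v = (THE w. w \<in> Sk \<and> u \<le> w \<and> v \<le> w \<and> (\<forall>z\<in>Sk. u \<le> z \<and> v \<le> z \<longrightarrow> w \<le> z))"

end

class balanced_residuated_posemigroup = residuated_posemigroup +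
  assumes balanced: "x \<setminus> x = x \<oslash> x"
    and positive_self_ldiv: "positive (x \<setminus> x)"
begin

definition tau :: "'a \<Rightarrow> 'a" where
  "tau x = x \<setminus> x"

definition layer :: "'a set \<Rightarrow> 'a set" where
  "layer A = {x. tau x \<in> A}"

definition layer_le :: "'a set \<Rightarrow> 'a \<Rightarrow> 'a \<Rightarrow> bool" where
  "layer_le C a b \<longleftrightarrow> a \<in> layer C \<and> b \<in> layer C \<and> a \<le> b"

definition star_tau :: "'a set \<Rightarrow> 'a set \<Rightarrow> 'a set" where
  "star_tau A B = (\<Union>x\<in>layer A. \<Union>y\<in>layer B. {tau (x * y), tau (x \<setminus> y), tau (x \<oslash> y)})"

definition tau_residuation_coherent :: "'a set set \<Rightarrow> bool" where
  "tau_residuation_coherent \<Omega> \<longleftrightarrow> partition_on Sk \<Omega> \<and>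
     (\<forall>A\<in>\<Omega>. \<forall>B\<in>\<Omega>. \<exists>!C. C \<in> \<Omega> \<and> C \<inter> star_tau A B \<noteq> {})"

text \<open>The choice of representatives \<open>u \<in> A\<close>, \<open>v \<in> B\<close> does not matter for blocks of a coherent
  partition, so the description below picks out exactly one block in that case.\<close>

definition block_join :: "'a set set \<Rightarrow> 'a set \<Rightarrow> 'a set \<Rightarrow> 'a set" where
  "block_join \<Omega> A B = (THE C. C \<in> \<Omega> \<and> (\<forall>u\<in>A. \<forall>v\<in>B. sk_join u v \<in> C))"

end

end

theory Submission
  imports Defs
begin

text \<open>Every positive idempotent \<open>p\<close> is central: \<open>p\<close> stabilises \<open>p * z\<close> on the left, and left and right
  stabilisers agree by balancedness, so \<open>z * p \<le> p * z * p \<le> p * z\<close>, and dually. Hence joins in the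
  skeleton are products. The block \<open>A \<or> B\<close> contains \<open>\<tau>(x * \<tau>(y))\<close> and \<open>\<tau>(y \<oslash> \<tau>(x))\<close> by
  coherence, and these are \<open>\<tau>(x * t)\<close> and \<open>\<tau>(y \<oslash> t)\<close> for \<open>t = \<tau>(x) * \<tau>(y)\<close>, because
  \<open>\<tau>(x)\<close> and \<open>\<tau>(y)\<close> are absorbed by \<open>x\<close> and \<open>y\<close>. As \<open>t\<close> is idempotent, \<open>x * t \<le> y \<oslash> t\<close> says
  \<open>x * t \<le> y\<close>.\<close>

section \<open>Residuation laws in an arbitrary residuated partially ordered semigroup\<close>

context residuated_posemigroup
begin

lemma mult_right_mono_le: "a \<le> b \<Longrightarrow> a * c \<le> b * c"
  using le_rdiv_iff order.trans order.refl by metis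

lemma mult_left_mono_le: "a \<le> b \<Longrightarrow> c * a \<le> c * b"
  using le_ldiv_iff order.trans order.refl by metis

lemma SkD:
  assumes "p \<in> Sk"
  shows "z \<le> z * p" and "z \<le> p * z" and "p * p = p"
  using assms by (auto simp: Sk_def positive_def)

lemma positive_mult: "positive p \<Longrightarrow> positive q \<Longrightarrow> positive (p * q)"
  unfolding positive_def by (metis mult.assoc order.trans)

lemma rdiv_mult_eq: "z \<oslash> (a * b) = (z \<oslash> b) \<oslash> a"
proof (rule order.antisym)
  show "z \<oslash> (a * b) \<le> (z \<oslash> b) \<oslash> a"
    by (simp flip: le_rdiv_iff add: mult.assoc) (simp add: le_rdiv_iff)
  have "(z \<oslash> b) \<oslash> a * a * b \<le> z"
    by (simp add: le_rdiv_iff)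
  then show "(z \<oslash> b) \<oslash> a \<le> z \<oslash> (a * b)"
    by (simp flip: le_rdiv_iff add: mult.assoc)
qed

text \<open>Centrality makes \<open>p * w \<le> y\<close> and \<open>w * p \<le> y\<close> one
  condition on \<open>w\<close>, so the residuals agree. This gives the form of the target
  comparison with \<open>t \<setminus> y\<close>.\<close>

lemma ldiv_eq_rdiv_if_central:
  assumes "\<And>z. p * z = z * p"
  shows "p \<setminus> y = y \<oslash> p"
proof (rule order.antisym)
  show "p \<setminus> y \<le> y \<oslash> p"
    by (simp flip: le_rdiv_iff add: assms[symmetric]) (simp add: le_ldiv_iff)
  show "y \<oslash> p \<le> p \<setminus> y"
    by (simp flip: le_ldiv_iff add: assms) (simp add: le_rdiv_iff)
qed

end

section \<open>Stabilisers, centrality and joins in the skeleton\<close>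

context balanced_residuated_posemigroup
begin

lemma tau_rdiv: "tau x = x \<oslash> x"
  by (simp add: tau_def balanced)

lemma mult_tau [simp]: "x * tau x = x"
proof (rule order.antisym)
  show "x * tau x \<le> x" by (simp add: le_ldiv_iff tau_def)
  show "x \<le> x * tau x" using positive_self_ldiv by (simp add: tau_def positive_def)
qed

lemma tau_mult [simp]: "tau x * x = x"
proof (rule order.antisym)
  show "tau x * x \<le> x" by (simp add: le_rdiv_iff tau_rdiv)
  show "x \<le> tau x * x" using positive_self_ldiv by (simp add: tau_def positive_def)
qed

text \<open>\<open>x\<close> absorbs \<open>tau x\<close> twice, so \<open>tau x * tau x\<close>
  lies below the residual \<open>x \<setminus> x\<close>; positivity gives the reverse
  inequality.\<close>

lemma tau_in_Sk [simp]: "tau x \<in> Sk"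
proof -
  have pos: "positive (tau x)"
    by (simp add: tau_def positive_self_ldiv)
  have "x * (tau x * tau x) \<le> x"
    by (simp flip: mult.assoc)
  then have "tau x * tau x \<le> tau x"
    by (simp add: le_ldiv_iff tau_def)
  moreover have "tau x \<le> tau x * tau x"
    using pos by (simp add: positive_def)
  ultimately show ?thesis
    using pos by (simp add: Sk_def order.antisym)
qed

text \<open>Positivity of \<open>p\<close> gives \<open>tau p \<le> p * tau p = p\<close>;
  idempotence residuates to the converse. Hence a subset of \<open>Sk\<close> lies in its own
  layer.\<close>

lemma tau_Sk: "p \<in> Sk \<Longrightarrow> tau p = p"
proof (rule order.antisym)
  assume p: "p \<in> Sk"
  show "tau p \<le> p"
    using SkD(2)[OF p, of "tau p"] by simp
  show "p \<le> tau p"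
    using SkD(3)[OF p] by (simp add: tau_def flip: le_ldiv_iff)
qed

lemma Sk_central:
  assumes p: "p \<in> Sk"
  shows "p * z = z * p"
proof (rule order.antisym)
  have "z * p * p \<le> z * p"
    by (simp add: mult.assoc SkD(3)[OF p])
  then have "p \<le> tau (z * p)"
    by (simp add: le_ldiv_iff tau_def)
  \<comment> \<open>The left residual \<open>tau (z * p)\<close> is now read as the right one, which
    moves the stabiliser \<open>p\<close> to the other side of \<open>z * p\<close>.\<close>
  then have "p * (z * p) \<le> z * p"
    by (simp add: tau_rdiv le_rdiv_iff)
  moreover have "p * z \<le> p * (z * p)"
    using SkD(1)[OF p, of "p * z"] by (simp add: mult.assoc)
  ultimately show "p * z \<le> z * p" by order
next
  have "p * (p * z) \<le> p * z"
    by (simp flip: mult.assoc add: SkD(3)[OF p])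
  then have "p \<le> tau (p * z)"
    by (simp add: le_rdiv_iff tau_rdiv)
  then have "p * z * p \<le> p * z"
    by (simp add: tau_def le_ldiv_iff)
  moreover have "z * p \<le> p * z * p"
    using SkD(2)[OF p, of "z * p"] by (simp add: mult.assoc)
  ultimately show "z * p \<le> p * z" by order
qed

lemma Sk_mult:
  assumes u: "u \<in> Sk" and v: "v \<in> Sk"
  shows "u * v \<in> Sk"
proof -
  have "u * v * (u * v) = u * (v * u) * v"
    by (simp add: mult.assoc)
  also have "\<dots> = u * u * (v * v)"
    by (simp add: mult.assoc Sk_central[OF v, of u])
  also have "\<dots> = u * v"
    by (simp add: SkD(3) u v)
  finally show ?thesis
    using u v by (simp add: Sk_def positive_mult)
qed

lemma sk_join_eq_mult:
  assumes u: "u \<in> Sk" and v: "v \<in> Sk"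
  shows "sk_join u v = u * v"
  unfolding sk_join_def
proof (rule the_equality)
  \<comment> \<open>The chain is \<open>u * v \<le> z * v \<le> z * z = z\<close>.\<close>
  have least: "u * v \<le> z" if "z \<in> Sk" "u \<le> z" "v \<le> z" for z
    using mult_right_mono_le[OF \<open>u \<le> z\<close>, of v] mult_left_mono_le[OF \<open>v \<le> z\<close>, of z]
      SkD(3)[OF \<open>z \<in> Sk\<close>] by order
  then show ub: "u * v \<in> Sk \<and> u \<le> u * v \<and> v \<le> u * v \<and>
      (\<forall>z\<in>Sk. u \<le> z \<and> v \<le> z \<longrightarrow> u * v \<le> z)"
    using Sk_mult[OF u v] SkD(1)[OF v] SkD(2)[OF u] by blast
  show "w = u * v"
    if "w \<in> Sk \<and> u \<le> w \<and> v \<le> w \<and> (\<forall>z\<in>Sk. u \<le> z \<and> v \<le> z \<longrightarrow> w \<le> z)" for w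
    using that ub by (meson order.antisym)
qed

lemma rdiv_tau [simp]: "y \<oslash> tau y = y"
proof (rule order.antisym)
  have "y \<oslash> tau y \<le> (y \<oslash> tau y) * tau y"
    by (rule SkD(1)) simp
  also have "\<dots> \<le> y"
    by (simp add: le_rdiv_iff)
  finally show "y \<oslash> tau y \<le> y" .
  show "y \<le> y \<oslash> tau y"
    by (simp flip: le_rdiv_iff)
qed

section \<open>Blocks of a coherent partition and their joins\<close>

lemma star_tau_subset_Sk: "star_tau A B \<subseteq> Sk"
  by (auto simp: star_tau_def)

lemma star_tau_mult: "x \<in> layer A \<Longrightarrow> y \<in> layer B \<Longrightarrow> tau (x * y) \<in> star_tau A B"
  by (auto simp: star_tau_def)

lemma star_tau_rdiv: "x \<in> layer A \<Longrightarrow> y \<in> layer B \<Longrightarrow> tau (x \<oslash> y) \<in> star_tau A B"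
  by (auto simp: star_tau_def)

lemma tau_in_layer: "x \<in> layer A \<Longrightarrow> tau x \<in> layer A"
  by (simp add: layer_def tau_Sk)

lemma coherent_partition: "tau_residuation_coherent \<Omega> \<Longrightarrow> partition_on Sk \<Omega>"
  by (simp add: tau_residuation_coherent_def)

lemma coherent_block_subset_Sk: "tau_residuation_coherent \<Omega> \<Longrightarrow> C \<in> \<Omega> \<Longrightarrow> C \<subseteq> Sk"
  using partition_onD1[OF coherent_partition] by blast

context
  fixes \<Omega> A B
  assumes coh: "tau_residuation_coherent \<Omega>" and A: "A \<in> \<Omega>" and B: "B \<in> \<Omega>"
begin

text \<open>Each element of \<open>star_tau A B\<close> lies in some block, which then meets that
  set; coherence admits only one such block.\<close>

lemma star_tau_subset_block:
  assumes "C \<in> \<Omega>" and "C \<inter> star_tau A B \<noteq> {}"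
  shows "star_tau A B \<subseteq> C"
proof
  fix s assume s: "s \<in> star_tau A B"
  then obtain D where "D \<in> \<Omega>" "s \<in> D"
    using star_tau_subset_Sk partition_onD1[OF coherent_partition[OF coh]] by blast
  moreover have "\<exists>!C. C \<in> \<Omega> \<and> C \<inter> star_tau A B \<noteq> {}"
    using coh A B by (simp add: tau_residuation_coherent_def)
  ultimately show "s \<in> C"
    using s assms by blast
qed

lemma mult_in_star_tau:
  assumes "u \<in> A" and "v \<in> B"
  shows "u * v \<in> star_tau A B"
proof -
  have uv: "u \<in> Sk" "v \<in> Sk"
    using assms A B coherent_block_subset_Sk[OF coh] by auto
  then have "u \<in> layer A" "v \<in> layer B"
    using assms by (simp_all add: layer_def tau_Sk)
  then show ?thesis
    using star_tau_mult tau_Sk[OF Sk_mult[OF uv]] by metis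
qed

text \<open>The joins are products, hence members of \<open>star_tau A B\<close>. A second candidate
  would share some \<open>u * v\<close> with \<open>C\<close>, against disjointness.\<close>

lemma block_join_eqI:
  assumes C: "C \<in> \<Omega>" and sub: "star_tau A B \<subseteq> C"
  shows "block_join \<Omega> A B = C"
  unfolding block_join_def
proof (rule the_equality)
  have join: "sk_join u v = u * v" if "u \<in> A" "v \<in> B" for u v
    using that A B coherent_block_subset_Sk[OF coh] by (meson sk_join_eq_mult subsetD)
  show "C \<in> \<Omega> \<and> (\<forall>u\<in>A. \<forall>v\<in>B. sk_join u v \<in> C)"
    using C sub mult_in_star_tau join by auto
  fix D assume D: "D \<in> \<Omega> \<and> (\<forall>u\<in>A. \<forall>v\<in>B. sk_join u v \<in> D)"
  obtain u v where uv: "u \<in> A" "v \<in> B"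
    using A B partition_onD3[OF coherent_partition[OF coh]] by (metis ex_in_conv)
  then have "u * v \<in> C \<inter> D"
    using D sub mult_in_star_tau join by auto
  then show "D = C"
    using D C partition_onD2[OF coherent_partition[OF coh]] by (auto dest: disjointD)
qed

lemma block_join_block: "block_join \<Omega> A B \<in> \<Omega>"
  and star_tau_subset_block_join: "star_tau A B \<subseteq> block_join \<Omega> A B"
proof -
  obtain C where C: "C \<in> \<Omega>" "C \<inter> star_tau A B \<noteq> {}"
    using coh A B unfolding tau_residuation_coherent_def by blast
  then have "star_tau A B \<subseteq> C"
    by (rule star_tau_subset_block)
  with C show "block_join \<Omega> A B \<in> \<Omega>" "star_tau A B \<subseteq> block_join \<Omega> A B"
    using block_join_eqI by auto
qed

end

text \<open>Needed because \<open>y \<oslash> tau x\<close> has its numerator in the layer of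
  \<open>B\<close>, so its \<open>tau\<close> is found in \<open>star_tau B A\<close>.\<close>

lemma block_join_commute:
  assumes coh: "tau_residuation_coherent \<Omega>" and A: "A \<in> \<Omega>" and B: "B \<in> \<Omega>"
  shows "block_join \<Omega> A B = block_join \<Omega> B A"
proof -
  obtain u v where uv: "u \<in> A" "v \<in> B"
    using A B partition_onD3[OF coherent_partition[OF coh]] by (metis ex_in_conv)
  have "u * v = v * u"
    using uv A coherent_block_subset_Sk[OF coh] Sk_central by blast
  then have "u * v \<in> star_tau B A"
    using mult_in_star_tau[OF coh B A] uv by simp
  then have "u * v \<in> block_join \<Omega> B A"
    using star_tau_subset_block_join[OF coh B A] by blast
  then have "block_join \<Omega> B A \<inter> star_tau A B \<noteq> {}"
    using mult_in_star_tau[OF coh A B] uv by blast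
  then have "star_tau A B \<subseteq> block_join \<Omega> B A"
    by (rule star_tau_subset_block[OF coh A B block_join_block[OF coh B A]])
  then show ?thesis
    by (rule block_join_eqI[OF coh A B block_join_block[OF coh B A]])
qed

end

section \<open>The order recovered from comparisons inside one layer\<close>

theorem theorem5p9:
  fixes \<Omega> :: "'a::balanced_residuated_posemigroup set set"
    and A B C :: "'a set"
    and x y t :: 'a
  assumes "tau_residuation_coherent \<Omega>"
    and "A \<in> \<Omega>" and "B \<in> \<Omega>"
    and "x \<in> layer A" and "y \<in> layer B"
    and "C = block_join \<Omega> A B"
    and "t = tau x * tau y"
  shows "(x \<le> y \<longleftrightarrow> (\<exists>q\<in>C. layer_le C (x * q) (y \<oslash> q)))
    \<and> t = sk_join (tau x) (tau y)
    \<and> (x \<le> y \<longrightarrow> t \<in> C \<and> layer_le C (x * t) (y \<oslash> t))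
    \<and> (\<forall>z. t * z = z * t)
    \<and> t * x = x * t
    \<and> (layer_le C (x * t) (y \<oslash> t) \<longleftrightarrow> layer_le C (t * x) (t \<setminus> y))"
proof -
  note coh = assms(1) and A = assms(2) and B = assms(3) and x = assms(4) and y = assms(5)
    and C = assms(6) and t = assms(7)
  have sub: "star_tau A B \<subseteq> C" "star_tau B A \<subseteq> C"
    using star_tau_subset_block_join[OF coh A B] star_tau_subset_block_join[OF coh B A]
      block_join_commute[OF coh A B] C by auto
  have C_Sk: "C \<subseteq> Sk"
    using C coherent_block_subset_Sk[OF coh block_join_block[OF coh A B]] by simp
  have t_Sk: "t \<in> Sk"
    by (simp add: t Sk_mult)
  have t_C: "t \<in> C"
    using mult_in_star_tau[OF coh A B] x y sub(1) t by (auto simp: layer_def)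
  have central: "t * z = z * t" for z
    by (rule Sk_central[OF t_Sk])
  have xt: "x * t = x * tau y"
    by (simp add: t flip: mult.assoc)
  \<comment> \<open>Dividing by a product reverses the factors: \<open>tau y\<close> is divided out
    first and is absorbed by \<open>rdiv_tau\<close>.\<close>
  have yt: "y \<oslash> t = y \<oslash> tau x"
    by (simp add: t rdiv_mult_eq)
  have layers: "x * t \<in> layer C" "y \<oslash> t \<in> layer C"
    using sub star_tau_mult[OF x tau_in_layer[OF y]] star_tau_rdiv[OF y tau_in_layer[OF x]]
    by (auto simp: xt yt layer_def)
  have witness: "layer_le C (x * t) (y \<oslash> t)" if "x \<le> y"
  proof -
    have "x * t * t = x * tau y"
      using mult.assoc SkD(3)[OF t_Sk] xt by metis
    also have "\<dots> \<le> y"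
      using mult_right_mono_le[OF that, of "tau y"] by simp
    finally show ?thesis
      using layers by (simp add: layer_le_def flip: le_rdiv_iff)
  qed
  have "x \<le> y" if q: "q \<in> C" and le: "layer_le C (x * q) (y \<oslash> q)" for q
  proof -
    have qS: "q \<in> Sk" using q C_Sk by blast
    \<comment> \<open>For an arbitrary witness, positivity of \<open>q\<close> inserts it twice,
      once for each side of the comparison.\<close>
    have "x \<le> x * q" by (rule SkD(1)[OF qS])
    also have "\<dots> \<le> x * q * q" by (rule SkD(1)[OF qS])
    also have "\<dots> \<le> y" using le by (simp add: layer_le_def le_rdiv_iff)
    finally show ?thesis .
  qed
  moreover have "t = sk_join (tau x) (tau y)"
    by (simp add: t sk_join_eq_mult)
  moreover have "t \<setminus> y = y \<oslash> t"
    by (rule ldiv_eq_rdiv_if_central[OF central])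
  ultimately show ?thesis
    using witness t_C central by metis
qed

end
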